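(* Let $A, C \in \mathbb{C}^{n\times n}$ be Hermitian matrices with $C$ indefinite, and let $\lambda(\mu)$ be a sorted eigencurve of $A-\mu C$, i.e. $\lambda=\lambda_j$ for some $j\in\{1,\dots,n\}$. If $(\mu_*,\lambda_* )$ is a local minimum or a local maximum of $\lambda$ (that is, $\lambda_*=\lambda(\mu_* )$ and $\mu_*\in\mathbb{R}$ is a local minimizer or local maximizer of $\mu\mapsto\lambda(\mu)$ on $\mathbb{R}$), then $(\mu_*,\lambda_* )$ is a 2D-eigenvalue of $(A,C)$.
   Context: A Hermitian matrix is indefinite if it has at least one positive and at least one negative eigenvalue. For $\mu\in\mathbb{R}$, let $\lambda_1(\mu)\ge\cdots\ge\lambda_n(\mu)$ be the eigenvalues of $A-\mu C$, counted with multiplicity; the functions $\lambda_j:\mathbb{R}\to\mathbb{R}$ are the sorted eigencurves of $A-\mu C$. A pair $(\mu,\lambda)\in\mathbb{R}\times\mathbb{R}$ is a 2D-eigenvalue of $(A,C)$ if there exists $x\in\mathbb{C}^n$ such that $(A-\mu C)x=\lambda x$, $x^HCx=0$ and $x^Hx=1$. *)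

theory Defs
  imports
    "Jordan_Normal_Form.Schur_Decomposition"
    "HOL-Computational_Algebra.Fundamental_Theorem_Algebra"
    "HOL-Library.Multiset"
begin

definition hermitian_mat :: "complex mat \<Rightarrow> bool" where
  "hermitian_mat M \<longleftrightarrow> mat_adjoint M = M"

definition indefinite_mat :: "complex mat \<Rightarrow> bool" where
  "indefinite_mat M \<longleftrightarrow> hermitian_mat M \<and>
     (\<exists>a::real. a > 0 \<and> eigenvalue M (complex_of_real a)) \<and>
     (\<exists>b::real. b < 0 \<and> eigenvalue M (complex_of_real b))"

text \<open>The eigenvalues in decreasing order, repeated by multiplicity as roots of the
  characteristic polynomial. For Hermitian matrices these roots are real (see
  \<open>hermitian_char_poly_root_real\<close> below), so taking real parts only changes the type.\<close>

definition sorted_eigenvalues :: "complex mat \<Rightarrow> real list" where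
  "sorted_eigenvalues M = rev (sorted_list_of_multiset (image_mset Re (proots (char_poly M))))"

definition pencil :: "complex mat \<Rightarrow> complex mat \<Rightarrow> real \<Rightarrow> complex mat" where
  "pencil A C \<mu> = A - complex_of_real \<mu> \<cdot>\<^sub>m C"

text \<open>The index \<open>j\<close> is one-based: \<open>j = 1\<close> gives the largest eigenvalue. Only
  \<open>1 \<le> j \<le> n\<close> is meaningful for matrices of size \<open>n\<close>.\<close>

definition eigencurve :: "complex mat \<Rightarrow> complex mat \<Rightarrow> nat \<Rightarrow> real \<Rightarrow> real" where
  "eigencurve A C j \<mu> = sorted_eigenvalues (pencil A C \<mu>) ! (j - 1)"

definition two_d_eigenvalue :: "complex mat \<Rightarrow> complex mat \<Rightarrow> real \<times> real \<Rightarrow> bool" where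
  "two_d_eigenvalue A C = (\<lambda>(\<mu>, l). \<exists>x \<in> carrier_vec (dim_row A).
     pencil A C \<mu> *\<^sub>v x = complex_of_real l \<cdot>\<^sub>v x \<and>
     conjugate x \<bullet> (C *\<^sub>v x) = 0 \<and>
     conjugate x \<bullet> x = 1)"

definition local_minimizer :: "(real \<Rightarrow> real) \<Rightarrow> real \<Rightarrow> bool" where
  "local_minimizer f t \<longleftrightarrow> (\<forall>\<^sub>F s in nhds t. f t \<le> f s)"

definition local_maximizer :: "(real \<Rightarrow> real) \<Rightarrow> real \<Rightarrow> bool" where
  "local_maximizer f t \<longleftrightarrow> (\<forall>\<^sub>F s in nhds t. f s \<le> f t)"

lemma hermitian_mat_iff:
  assumes "M \<in> carrier_mat n n"
  shows "hermitian_mat M \<longleftrightarrow> (\<forall>i<n. \<forall>j<n. M $$ (i, j) = cnj (M $$ (j, i)))"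
proof -
  have "mat_adjoint M = mat n n (\<lambda>(i, j). cnj (M $$ (j, i)))"
    using assms by (intro eq_matI) (auto simp: mat_adjoint_def mat_of_rows_index)
  then have "hermitian_mat M \<longleftrightarrow> mat n n (\<lambda>(i, j). cnj (M $$ (j, i))) = M"
    unfolding hermitian_mat_def by simp
  also have "\<dots> \<longleftrightarrow> (\<forall>i<n. \<forall>j<n. cnj (M $$ (j, i)) = M $$ (i, j))"
    using assms by (simp add: mat_eq_iff)
  finally show ?thesis
    unfolding eq_commute[of "cnj _"] .
qed

lemma length_sorted_eigenvalues:
  assumes "M \<in> carrier_mat n n"
  shows "length (sorted_eigenvalues M) = n"
proof -
  have "length (sorted_eigenvalues M) = size (proots (char_poly M))"
    unfolding sorted_eigenvalues_def length_rev
    by (metis mset_sorted_list_of_multiset size_image_mset size_mset)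
  then show ?thesis
    using degree_monic_char_poly[OF assms] by (simp add: size_proots_complex)
qed

lemma hermitian_char_poly_root_real:
  assumes M: "M \<in> carrier_mat n n" and "hermitian_mat M" and z: "z \<in># proots (char_poly M)"
  shows "z \<in> \<real>"
proof -
  have "poly (char_poly M) z = 0"
    using z by (cases "char_poly M = 0") auto
  then obtain v where v: "v \<in> carrier_vec n" "v \<noteq> 0\<^sub>v n" and ev: "M *\<^sub>v v = z \<cdot>\<^sub>v v"
    using eigenvalue_root_char_poly[OF M] M unfolding eigenvalue_def eigenvector_def by auto
  have herm: "M $$ (i, j) = cnj (M $$ (j, i))" if "i < n" "j < n" for i j
    using assms(2) that hermitian_mat_iff[OF M] by blast
  define q where "q = (\<Sum>i<n. \<Sum>j<n. cnj (v $ i) * M $$ (i, j) * v $ j)"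
  define s where "s = (\<Sum>i<n. cnj (v $ i) * v $ i)"
  have "cnj q = (\<Sum>i<n. \<Sum>j<n. cnj (v $ j) * M $$ (j, i) * v $ i)"
    unfolding q_def cnj_sum by (intro sum.cong refl) (simp add: herm[symmetric] mult.commute)
  also have "\<dots> = q"
    unfolding q_def by (rule sum.swap)
  finally have q_real: "cnj q = q" .
  have row: "(\<Sum>j<n. M $$ (i, j) * v $ j) = z * v $ i" if "i < n" for i
  proof -
    have "(M *\<^sub>v v) $ i = (\<Sum>j<n. M $$ (i, j) * v $ j)"
      using M v that by (auto simp: scalar_prod_def atLeast0LessThan intro!: sum.cong)
    then show ?thesis
      using ev v that by auto
  qed
  have "q = (\<Sum>i<n. cnj (v $ i) * (\<Sum>j<n. M $$ (i, j) * v $ j))"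
    unfolding q_def by (simp add: sum_distrib_left mult.assoc)
  also have "\<dots> = z * s"
    by (simp add: s_def row sum_distrib_left[of z] mult.left_commute)
  finally have qs: "q = z * s" .
  have s: "s = conjugate v \<bullet> v"
    using v by (auto simp: s_def scalar_prod_def atLeast0LessThan)
  then have "s \<noteq> 0"
    using v conjugate_vec_sprod_comm[of v n v] conjugate_square_eq_0_vec[of v n] by simp
  moreover have "cnj s = s"
    unfolding s_def by (simp add: mult.commute)
  ultimately have "cnj z = z"
    using q_real unfolding qs complex_cnj_mult by (metis mult_right_cancel)
  then show ?thesis
    by (simp add: Reals_cnj_iff)
qed

end

theory Submission
  imports Defs
begin

text \<open>Let \<open>s\<^sub>k \<longlonglongrightarrow> \<mu>\<close> and let \<open>v\<^sub>k\<close> be unit eigenvectors of \<open>A - s\<^sub>k C\<close> for \<open>\<lambda>(s\<^sub>k)\<close>. By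
  compactness and continuity of \<open>\<lambda>\<close>, along a subsequence \<open>v\<^sub>k\<close> converges to a unit eigenvector
  \<open>x\<close> of \<open>A - \<mu> C\<close> for \<open>\<lambda>(\<mu>)\<close>, and pairing \<open>(A - s\<^sub>k C) v\<^sub>k = \<lambda>(s\<^sub>k) v\<^sub>k\<close> with \<open>x\<close> shows that
  the difference quotients of \<open>\<lambda>\<close> tend to \<open>- x\<^sup>H C x\<close>. At a local extremum, sequences from the
  right and from the left thus yield two unit eigenvectors at which the form of \<open>C\<close> has opposite
  (weak) signs; on the segment between them, which lies in the eigenspace, the form vanishes.\<close>

section \<open>Compactness, coordinate by coordinate\<close>

text \<open>Induction on the number of coordinates: a subsequence that works for the first
  \<open>n\<close> is thinned once more for coordinate \<open>n\<close>, and the limits already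
  found survive. It serves both lists of eigenvalues and unit eigenvectors.\<close>

lemma Bolzano_Weierstrass_complex_family:
  fixes f :: "nat \<Rightarrow> nat \<Rightarrow> complex"
  assumes "\<And>k i. i < n \<Longrightarrow> cmod (f k i) \<le> r"
  shows "\<exists>g l. strict_mono (g :: nat \<Rightarrow> nat) \<and> (\<forall>i<n. (\<lambda>k. f (g k) i) \<longlonglongrightarrow> l i)"
  using assms
proof (induction n)
  case 0
  then show ?case
    using strict_mono_id by auto
next
  case (Suc n)
  then obtain g l where g: "strict_mono (g :: nat \<Rightarrow> nat)"
    and l: "\<forall>i<n. (\<lambda>k. f (g k) i) \<longlonglongrightarrow> l i"
    by (metis less_SucI)
  have "\<forall>k. cmod (f (g k) n) \<le> r"
    using Suc.prems by simp
  from Bolzano_Weierstrass_complex_disc[OF this] obtain h z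
    where h: "strict_mono (h :: nat \<Rightarrow> nat)" and "\<forall>e>0. \<exists>N. \<forall>k\<ge>N. cmod (f (g (h k)) n - z) < e"
    by blast
  then have z: "(\<lambda>k. f (g (h k)) n) \<longlonglongrightarrow> z"
    by (simp add: LIMSEQ_iff)
  have "(\<lambda>k. f ((g \<circ> h) k) i) \<longlonglongrightarrow> (l(n := z)) i" if "i < Suc n" for i
    using that z LIMSEQ_subseq_LIMSEQ[OF l[rule_format] h, of i]
    by (cases "i = n") (auto simp: o_def less_Suc_eq)
  then show ?case
    using strict_mono_o[OF g h] by blast
qed

section \<open>Sesquilinear forms and unit vectors in coordinates\<close>

lemma index_mult_mat_vec_sum:
  assumes "M \<in> carrier_mat n n" "x \<in> carrier_vec n" "i < n"
  shows "(M *\<^sub>v x) $ i = (\<Sum>j<n. M $$ (i, j) * x $ j)"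
  using assms by (auto simp: scalar_prod_def atLeast0LessThan intro!: sum.cong)

lemma conjugate_scalar_prod_sum:
  fixes x y :: "complex vec"
  assumes "x \<in> carrier_vec n" "y \<in> carrier_vec n"
  shows "conjugate x \<bullet> y = (\<Sum>i<n. cnj (x $ i) * y $ i)"
  using assms by (auto simp: scalar_prod_def atLeast0LessThan)

lemma sesquilinear_form_sum:
  fixes M :: "complex mat"
  assumes "M \<in> carrier_mat n n" "x \<in> carrier_vec n" "y \<in> carrier_vec n"
  shows "conjugate x \<bullet> (M *\<^sub>v y) = (\<Sum>i<n. \<Sum>j<n. cnj (x $ i) * (M $$ (i, j) * y $ j))"
  using assms by (simp add: conjugate_scalar_prod_sum[of _ n] index_mult_mat_vec_sum sum_distrib_left
      del: index_mult_mat_vec)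

text \<open>Conjugation turns entry (i, j) into entry (j, i), and exchanging the two sums restores
  the form. With \<open>x = y\<close> this makes the form real; with \<open>x\<close> and
  \<open>y\<close> distinct it moves the matrix to the other argument.\<close>

lemma hermitian_form_swap:
  assumes M: "M \<in> carrier_mat n n" and herm: "hermitian_mat M"
    and x: "x \<in> carrier_vec n" and y: "y \<in> carrier_vec n"
  shows "conjugate x \<bullet> (M *\<^sub>v y) = cnj (conjugate y \<bullet> (M *\<^sub>v x))"
proof -
  have "cnj (conjugate y \<bullet> (M *\<^sub>v x))
      = (\<Sum>i<n. \<Sum>j<n. cnj (x $ j) * (cnj (M $$ (i, j)) * y $ i))"
    unfolding sesquilinear_form_sum[OF M y x] by (simp add: mult_ac)
  also have "\<dots> = (\<Sum>i<n. \<Sum>j<n. cnj (x $ j) * (M $$ (j, i) * y $ i))"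
  proof (intro sum.cong refl)
    fix i j assume "i \<in> {..<n}" "j \<in> {..<n}"
    then have "M $$ (j, i) = cnj (M $$ (i, j))"
      using herm hermitian_mat_iff[OF M] by blast
    then show "cnj (x $ j) * (cnj (M $$ (i, j)) * y $ i) = cnj (x $ j) * (M $$ (j, i) * y $ i)"
      by simp
  qed
  also have "\<dots> = conjugate x \<bullet> (M *\<^sub>v y)"
    unfolding sesquilinear_form_sum[OF M x y] by (rule sum.swap)
  finally show ?thesis ..
qed

lemma conjugate_scalar_prod_self:
  fixes x :: "complex vec"
  assumes "x \<in> carrier_vec n"
  shows "conjugate x \<bullet> x = complex_of_real (\<Sum>i<n. (cmod (x $ i))\<^sup>2)"
  unfolding conjugate_scalar_prod_sum[OF assms assms]
  by (simp only: of_real_sum complex_norm_square mult.commute)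

lemma cmod_index_le_1:
  fixes x :: "complex vec"
  assumes x: "x \<in> carrier_vec n" and "conjugate x \<bullet> x = 1" and i: "i < n"
  shows "cmod (x $ i) \<le> 1"
proof -
  have "complex_of_real (\<Sum>i<n. (cmod (x $ i))\<^sup>2) = complex_of_real 1"
    using assms by (simp only: conjugate_scalar_prod_self[OF x] of_real_1)
  then have "(\<Sum>i<n. (cmod (x $ i))\<^sup>2) = 1"
    by (simp only: of_real_eq_iff)
  moreover have "(cmod (x $ i))\<^sup>2 \<le> (\<Sum>i<n. (cmod (x $ i))\<^sup>2)"
    by (rule member_le_sum) (use i in auto)
  ultimately show ?thesis
    by (simp add: power_le_one_iff abs_square_le_1)
qed

lemma smult_unit_vec_exists:
  fixes x :: "complex vec"
  assumes x: "x \<in> carrier_vec n" and "x \<noteq> 0\<^sub>v n"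
  obtains a where "a > 0"
    and "conjugate (complex_of_real a \<cdot>\<^sub>v x) \<bullet> (complex_of_real a \<cdot>\<^sub>v x) = 1"
proof -
  define s where "s = (\<Sum>i<n. (cmod (x $ i))\<^sup>2)"
  obtain i where i: "i < n" "x $ i \<noteq> 0"
    using assms by (metis carrier_vecD eq_vecI index_zero_vec)
  have "s > 0"
    unfolding s_def by (rule sum_pos2[of _ i]) (use i in auto)
  define a where "a = 1 / sqrt s"
  have ax: "complex_of_real a \<cdot>\<^sub>v x \<in> carrier_vec n"
    using x by simp
  have "(\<Sum>i<n. (cmod ((complex_of_real a \<cdot>\<^sub>v x) $ i))\<^sup>2) = a\<^sup>2 * s"
    using x by (simp add: s_def norm_mult power_mult_distrib sum_distrib_left)
  also have "\<dots> = 1"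
    using \<open>s > 0\<close> by (simp add: a_def power_divide)
  finally have "conjugate (complex_of_real a \<cdot>\<^sub>v x) \<bullet> (complex_of_real a \<cdot>\<^sub>v x) = 1"
    by (simp only: conjugate_scalar_prod_self[OF ax] of_real_1)
  moreover have "a > 0"
    using \<open>s > 0\<close> by (simp add: a_def)
  ultimately show ?thesis
    using that by blast
qed

lemma smult_eigenvector:
  fixes M :: "complex mat"
  assumes M: "M \<in> carrier_mat n n" and x: "x \<in> carrier_vec n" and "M *\<^sub>v x = z \<cdot>\<^sub>v x"
  shows "M *\<^sub>v (a \<cdot>\<^sub>v x) = z \<cdot>\<^sub>v (a \<cdot>\<^sub>v x)"
  using assms by (simp add: mult_mat_vec[OF M x] smult_smult_assoc mult.commute)

lemma unit_eigenvector_exists: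
  fixes M :: "complex mat"
  assumes M: "M \<in> carrier_mat n n" and "eigenvalue M z"
  shows "\<exists>x\<in>carrier_vec n. M *\<^sub>v x = z \<cdot>\<^sub>v x \<and> conjugate x \<bullet> x = 1"
proof -
  obtain x where x: "x \<in> carrier_vec n" "x \<noteq> 0\<^sub>v n" "M *\<^sub>v x = z \<cdot>\<^sub>v x"
    using assms unfolding eigenvalue_def eigenvector_def by auto
  obtain a where "conjugate (complex_of_real a \<cdot>\<^sub>v x) \<bullet> (complex_of_real a \<cdot>\<^sub>v x) = 1"
    using smult_unit_vec_exists[OF x(1,2)] .
  then show ?thesis
    using smult_eigenvector[OF M x(1) x(3), of "complex_of_real a"] x(1)
    by (intro bexI[of _ "complex_of_real a \<cdot>\<^sub>v x"]) auto
qed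

section \<open>Bounds and factorisation for the sorted spectrum\<close>

text \<open>A unit eigenvector \<open>x\<close> gives z = x^H M x, and its coordinates have modulus
  at most 1. The bound is crude but continuous in the entries, so it is uniform along a convergent
  sequence of matrices.\<close>

lemma cmod_eigenvalue_le:
  fixes M :: "complex mat"
  assumes M: "M \<in> carrier_mat n n" and "eigenvalue M z"
  shows "cmod z \<le> (\<Sum>i<n. \<Sum>j<n. cmod (M $$ (i, j)))"
proof -
  obtain x where x: "x \<in> carrier_vec n" and ev: "M *\<^sub>v x = z \<cdot>\<^sub>v x" and unit: "conjugate x \<bullet> x = 1"
    using unit_eigenvector_exists[OF assms] by blast
  have "z = conjugate x \<bullet> (M *\<^sub>v x)"
    using x unit by (simp add: ev)
  also have "\<dots> = (\<Sum>i<n. \<Sum>j<n. cnj (x $ i) * (M $$ (i, j) * x $ j))"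
    by (rule sesquilinear_form_sum[OF M x x])
  also have "cmod \<dots> \<le> (\<Sum>i<n. \<Sum>j<n. cmod (M $$ (i, j)))"
  proof (intro sum_norm_le)
    fix i j assume "i \<in> {..<n}" "j \<in> {..<n}"
    then have "cmod (x $ i) \<le> 1" "cmod (x $ j) \<le> 1"
      using cmod_index_le_1[OF x unit] by auto
    then show "cmod (cnj (x $ i) * (M $$ (i, j) * x $ j)) \<le> cmod (M $$ (i, j))"
      by (simp add: norm_mult) (meson mult_left_le mult_left_le_one_le mult_nonneg_nonneg norm_ge_zero order_trans)
  qed
  finally show ?thesis .
qed

lemma image_mset_sorted_eigenvalues:
  assumes "M \<in> carrier_mat n n" "hermitian_mat M"
  shows "image_mset complex_of_real (mset (sorted_eigenvalues M)) = proots (char_poly M)"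
proof -
  have "image_mset (complex_of_real \<circ> Re) (proots (char_poly M)) = image_mset id (proots (char_poly M))"
    using hermitian_char_poly_root_real[OF assms] by (intro image_mset_cong) (simp add: of_real_Re)
  then show ?thesis
    by (simp add: sorted_eigenvalues_def multiset.map_comp)
qed

lemma eigenvalue_sorted_eigenvalues:
  assumes M: "M \<in> carrier_mat n n" and herm: "hermitian_mat M" and "i < n"
  shows "eigenvalue M (complex_of_real (sorted_eigenvalues M ! i))"
proof -
  have "complex_of_real (sorted_eigenvalues M ! i)
      \<in># image_mset complex_of_real (mset (sorted_eigenvalues M))"
    using \<open>i < n\<close> length_sorted_eigenvalues[OF M] by auto
  then have "complex_of_real (sorted_eigenvalues M ! i) \<in># proots (char_poly M)"
    unfolding image_mset_sorted_eigenvalues[OF M herm] .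
  then show ?thesis
    by (cases "char_poly M = 0") (auto simp: eigenvalue_root_char_poly[OF M])
qed

text \<open>The characteristic polynomial splits over the complex numbers. Indexing the factors by
  position rather than by root lets limits be taken factor by factor.\<close>

lemma char_poly_sorted_eigenvalues:
  assumes M: "M \<in> carrier_mat n n" and herm: "hermitian_mat M"
  shows "char_poly M = (\<Prod>i<n. [:- complex_of_real (sorted_eigenvalues M ! i), 1:])"
proof -
  let ?es = "sorted_eigenvalues M"
  have "char_poly M = (\<Prod>x\<in>#proots (char_poly M). [:-x, 1:])"
    using complex_poly_decompose_multiset[of "char_poly M"] degree_monic_char_poly[OF M] by simp
  also have "\<dots> = (\<Prod>x\<leftarrow>?es. [:- complex_of_real x, 1:])"
    by (simp add: image_mset_sorted_eigenvalues[OF M herm, symmetric] multiset.map_comp o_def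
        flip: prod_mset_prod_list mset_map)
  also have "\<dots> = (\<Prod>i<n. [:- complex_of_real (?es ! i), 1:])"
    by (simp add: prod.list_conv_set_nth length_sorted_eigenvalues[OF M] atLeast0LessThan)
  finally show ?thesis .
qed

lemma rev_sorted_list_of_multiset_mset:
  fixes xs :: "'a :: linorder list"
  assumes "sorted (rev xs)"
  shows "rev (sorted_list_of_multiset (mset xs)) = xs"
proof -
  have "sorted_list_of_multiset (mset (rev xs)) = rev xs"
    using assms by (metis sorted_list_of_multiset_mset sorted_sort_id)
  then show ?thesis
    by simp
qed

lemma proots_prod_linear_factors:
  fixes f :: "'b \<Rightarrow> 'a :: idom"
  shows "proots (\<Prod>x\<leftarrow>xs. [:- f x, 1:]) = image_mset f (mset xs)"
proof (induction xs)
  case (Cons x xs)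
  have "(\<Prod>x\<leftarrow>xs. [:- f x, 1:]) \<noteq> 0"
    by (auto simp: prod_list_zero_iff)
  then show ?case
    using Cons by (simp add: proots_mult del: mult_pCons_left)
qed simp

section \<open>Continuity of the sorted spectrum along subsequences\<close>

text \<open>By the Leibniz formula the value at \<open>z\<close> is a finite sum of products of
  entries, hence continuous in the entries.\<close>

lemma tendsto_poly_char_poly:
  fixes M :: "'b \<Rightarrow> complex mat"
  assumes M: "\<And>k. M k \<in> carrier_mat n n" and N: "N \<in> carrier_mat n n"
    and lim: "\<And>i j. i < n \<Longrightarrow> j < n \<Longrightarrow> ((\<lambda>k. M k $$ (i, j)) \<longlongrightarrow> N $$ (i, j)) F"
  shows "((\<lambda>k. poly (char_poly (M k)) z) \<longlongrightarrow> poly (char_poly N) z) F"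
proof -
  have eq: "poly (char_poly L) z = (\<Sum>p | p permutes {0..<n}.
      signof p * (\<Prod>i = 0..<n. (if i = p i then z else 0) - L $$ (i, p i)))"
    if L: "L \<in> carrier_mat n n" for L :: "complex mat"
  proof -
    have cm: "- char_matrix L z \<in> carrier_mat n n"
      using L by simp
    have "poly (char_poly L) z = det (- char_matrix L z)"
      by (rule char_poly_matrix[OF L])
    also have "\<dots> = (\<Sum>p | p permutes {0..<n}.
      signof p * (\<Prod>i = 0..<n. (- char_matrix L z) $$ (i, p i)))"
      unfolding det_def'[OF cm] ..
    also have "\<dots> = (\<Sum>p | p permutes {0..<n}.
      signof p * (\<Prod>i = 0..<n. (if i = p i then z else 0) - L $$ (i, p i)))"
      using L by (intro sum.cong prod.cong arg_cong2[where f = "(*)"] refl)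
        (auto simp: char_matrix_def permutes_def permutes_in_image)
    finally show ?thesis .
  qed
  show ?thesis
    unfolding eq[OF M] eq[OF N]
  proof (intro tendsto_sum tendsto_mult tendsto_prod tendsto_diff tendsto_const)
    fix p i assume "p \<in> {p. p permutes {0..<n}}" "i \<in> {0..<n}"
    then show "((\<lambda>k. M k $$ (i, p i)) \<longlongrightarrow> N $$ (i, p i)) F"
      by (intro lim) (auto dest: permutes_in_image)
  qed
qed

text \<open>A limit point of the sorted spectra is a decreasing list with the limiting
  characteristic polynomial, hence it is the sorted spectrum of the limit matrix.\<close>

lemma sorted_eigenvalues_subseq_tendsto:
  assumes M: "\<And>k. M k \<in> carrier_mat n n" and Mh: "\<And>k. hermitian_mat (M k)"
    and N: "N \<in> carrier_mat n n" and Nh: "hermitian_mat N"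
    and lim: "\<And>i j. i < n \<Longrightarrow> j < n \<Longrightarrow> (\<lambda>k. M k $$ (i, j)) \<longlonglongrightarrow> N $$ (i, j)"
  obtains g where "strict_mono (g :: nat \<Rightarrow> nat)"
    and "\<And>i. i < n \<Longrightarrow> (\<lambda>k. sorted_eigenvalues (M (g k)) ! i) \<longlonglongrightarrow> sorted_eigenvalues N ! i"
proof -
  let ?e = "\<lambda>k i. sorted_eigenvalues (M k) ! i"
  \<comment> \<open>These eigenvalue bounds converge, so a single \<open>K\<close> bounds all
    eigenvalues of all \<open>M k\<close>.\<close>
  have "(\<lambda>k. \<Sum>i<n. \<Sum>j<n. cmod (M k $$ (i, j))) \<longlonglongrightarrow> (\<Sum>i<n. \<Sum>j<n. cmod (N $$ (i, j)))"
    by (intro tendsto_sum tendsto_norm lim) auto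
  then have "Bseq (\<lambda>k. \<Sum>i<n. \<Sum>j<n. cmod (M k $$ (i, j)))"
    by (blast intro: convergent_imp_Bseq convergentI)
  then obtain K where K: "\<And>k. norm (\<Sum>i<n. \<Sum>j<n. cmod (M k $$ (i, j))) \<le> K"
    unfolding Bseq_def by blast
  have bound: "cmod (complex_of_real (?e k i)) \<le> K" if "i < n" for k i
    using cmod_eigenvalue_le[OF M eigenvalue_sorted_eigenvalues[OF M Mh that], of k] K[of k]
    by auto
  obtain g w where g: "strict_mono (g :: nat \<Rightarrow> nat)"
    and w: "\<And>i. i < n \<Longrightarrow> (\<lambda>k. complex_of_real (?e (g k) i)) \<longlonglongrightarrow> w i"
    using Bolzano_Weierstrass_complex_family[of n "\<lambda>k i. complex_of_real (?e k i)", OF bound] by blast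
  define es where "es = map (\<lambda>i. Re (w i)) [0..<n]"
  have es: "(\<lambda>k. ?e (g k) i) \<longlonglongrightarrow> es ! i" if "i < n" for i
    using tendsto_Re[OF w[OF that]] that by (simp add: es_def)
  have es': "(\<lambda>k. complex_of_real (?e (g k) i)) \<longlonglongrightarrow> complex_of_real (es ! i)" if "i < n" for i
    by (intro tendsto_of_real es that)
  \<comment> \<open>Weak inequalities pass to the limit, so the limit list inherits the decreasing
    order.\<close>
  have "es ! j \<le> es ! i" if "i \<le> j" "j < n" for i j
  proof (rule LIMSEQ_le[OF es es])
    have "?e k j \<le> ?e k i" for k
    proof -
      have "sorted (rev (sorted_eigenvalues (M k)))"
        by (simp add: sorted_eigenvalues_def)
      then show ?thesis
        using that length_sorted_eigenvalues[OF M] by (simp add: sorted_rev_iff_nth_mono)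
    qed
    then show "\<exists>K. \<forall>k\<ge>K. ?e (g k) j \<le> ?e (g k) i"
      by blast
  qed (use that in auto)
  then have sorted: "sorted (rev es)"
    by (simp add: sorted_rev_iff_nth_mono es_def)
  \<comment> \<open>Both sides are limits of the same values: one by continuity in the entries, the
    other by convergence of the roots.\<close>
  have "poly (char_poly N) z = poly (\<Prod>i<n. [:- complex_of_real (es ! i), 1:]) z" for z
  proof (rule LIMSEQ_unique)
    show "(\<lambda>k. poly (char_poly (M (g k))) z) \<longlonglongrightarrow> poly (char_poly N) z"
      using LIMSEQ_subseq_LIMSEQ[OF tendsto_poly_char_poly[OF M N lim] g] by (simp add: o_def)
    show "(\<lambda>k. poly (char_poly (M (g k))) z) \<longlonglongrightarrow> poly (\<Prod>i<n. [:- complex_of_real (es ! i), 1:]) z"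
      unfolding char_poly_sorted_eigenvalues[OF M Mh] poly_prod
      by (auto intro!: tendsto_intros es')
  qed
  then have "char_poly N = (\<Prod>i<n. [:- complex_of_real (es ! i), 1:])"
    by (simp add: poly_eq_poly_eq_iff[symmetric] fun_eq_iff)
  also have "\<dots> = (\<Prod>x\<leftarrow>es. [:- complex_of_real x, 1:])"
    by (simp add: prod.list_conv_set_nth es_def atLeast0LessThan)
  finally have "proots (char_poly N) = image_mset complex_of_real (mset es)"
    by (simp add: proots_prod_linear_factors)
  then have "image_mset Re (proots (char_poly N)) = mset es"
    by (simp add: multiset.map_comp o_def)
  then have "sorted_eigenvalues N = es"
    using rev_sorted_list_of_multiset_mset[OF sorted] by (simp add: sorted_eigenvalues_def)
  then show ?thesis
    using that g es by simp
qed

section \<open>Difference quotients of an eigencurve\<close>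

lemma pencil_carrier:
  assumes "A \<in> carrier_mat n n" "C \<in> carrier_mat n n"
  shows "pencil A C t \<in> carrier_mat n n"
  using assms unfolding pencil_def by (intro minus_carrier_mat smult_carrier_mat)

lemma hermitian_pencil:
  assumes A: "A \<in> carrier_mat n n" and C: "C \<in> carrier_mat n n"
    and "hermitian_mat A" "hermitian_mat C"
  shows "hermitian_mat (pencil A C t)"
  unfolding hermitian_mat_iff[OF pencil_carrier[OF A C]]
proof (intro allI impI)
  fix i j assume ij: "i < n" "j < n"
  then have "A $$ (i, j) = cnj (A $$ (j, i))" "C $$ (i, j) = cnj (C $$ (j, i))"
    using assms hermitian_mat_iff by blast+
  then show "pencil A C t $$ (i, j) = cnj (pencil A C t $$ (j, i))"
    using A C ij by (simp add: pencil_def)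
qed

text \<open>A substitute for differentiability: at a multiple eigenvalue the vector \<open>x\<close>
  and the limit may depend on the sequence \<open>s\<close>, for instance on the side from which it
  approaches \<mu>.\<close>

lemma eigencurve_difference_quotient:
  assumes A: "A \<in> carrier_mat n n" and C: "C \<in> carrier_mat n n"
    and Ah: "hermitian_mat A" and Ch: "hermitian_mat C" and j: "j \<in> {1..n}"
    and s: "s \<longlonglongrightarrow> \<mu>" and s_ne: "\<And>k. s k \<noteq> \<mu>"
  obtains x g where "x \<in> carrier_vec n" "conjugate x \<bullet> x = 1"
    and "pencil A C \<mu> *\<^sub>v x = complex_of_real (eigencurve A C j \<mu>) \<cdot>\<^sub>v x"
    and "strict_mono (g :: nat \<Rightarrow> nat)"
    and "(\<lambda>k. (eigencurve A C j (s (g k)) - eigencurve A C j \<mu>) / (s (g k) - \<mu>))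
      \<longlonglongrightarrow> - Re (conjugate x \<bullet> (C *\<^sub>v x))"
proof -
  note P = pencil_carrier[OF A C] and Ph = hermitian_pencil[OF A C Ah Ch]
  let ?e = "eigencurve A C j"
  have entries: "(\<lambda>k. pencil A C (s k) $$ (p, q)) \<longlonglongrightarrow> pencil A C \<mu> $$ (p, q)"
    if "p < n" "q < n" for p q
    using that A C by (auto simp: pencil_def intro!: tendsto_intros s)
  \<comment> \<open>The curve is entry \<open>j - 1\<close> of the sorted list, and
    \<open>j - 1 < n\<close>. Convergence along one subsequence is enough here.\<close>
  obtain g1 where g1: "strict_mono (g1 :: nat \<Rightarrow> nat)"
    and e1: "(\<lambda>k. ?e (s (g1 k))) \<longlonglongrightarrow> ?e \<mu>"
    using sorted_eigenvalues_subseq_tendsto[OF P Ph P Ph entries] j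
    unfolding eigencurve_def by (metis One_nat_def Suc_le_eq Suc_pred atLeastAtMost_iff zero_less_one less_le_trans)
  have "\<exists>x\<in>carrier_vec n. pencil A C t *\<^sub>v x = complex_of_real (?e t) \<cdot>\<^sub>v x \<and> conjugate x \<bullet> x = 1"
    for t
    unfolding eigencurve_def
    by (intro unit_eigenvector_exists[OF P] eigenvalue_sorted_eigenvalues[OF P Ph]) (use j in auto)
  \<comment> \<open>An arbitrary choice of unit eigenvectors, with no continuity in
    \<open>t\<close>; compactness supplies the limit \<open>x\<close>.\<close>
  then obtain v where v: "\<And>t. v t \<in> carrier_vec n"
    and v_ev: "\<And>t. pencil A C t *\<^sub>v v t = complex_of_real (?e t) \<cdot>\<^sub>v v t"
    and v_unit: "\<And>t. conjugate (v t) \<bullet> v t = 1"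
    by metis
  obtain g2 w where g2: "strict_mono (g2 :: nat \<Rightarrow> nat)"
    and w: "\<forall>i<n. (\<lambda>k. v (s (g1 (g2 k))) $ i) \<longlonglongrightarrow> w i"
    using Bolzano_Weierstrass_complex_family[of n "\<lambda>k i. v (s (g1 k)) $ i" 1]
      cmod_index_le_1[OF v v_unit] by blast
  define g where "g = g1 \<circ> g2"
  define x where "x = vec n w"
  have g: "strict_mono g"
    unfolding g_def by (rule strict_mono_o[OF g1 g2])
  have x: "x \<in> carrier_vec n"
    by (simp add: x_def)
  have vx: "(\<lambda>k. v (s (g k)) $ i) \<longlonglongrightarrow> x $ i" if "i < n" for i
    using w that by (simp add: x_def g_def)
  have e: "(\<lambda>k. complex_of_real (?e (s (g k)))) \<longlonglongrightarrow> complex_of_real (?e \<mu>)"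
    using LIMSEQ_subseq_LIMSEQ[OF e1 g2] by (auto simp: g_def o_def intro: tendsto_of_real)
  have entries': "(\<lambda>k. pencil A C (s (g k)) $$ (p, q)) \<longlonglongrightarrow> pencil A C \<mu> $$ (p, q)"
    if "p < n" "q < n" for p q
    using LIMSEQ_subseq_LIMSEQ[OF entries[OF that] g] by (simp add: o_def)
  have x_unit: "conjugate x \<bullet> x = 1"
  proof (rule LIMSEQ_unique)
    show "(\<lambda>k. conjugate (v (s (g k))) \<bullet> v (s (g k))) \<longlonglongrightarrow> conjugate x \<bullet> x"
      unfolding conjugate_scalar_prod_sum[OF v v] conjugate_scalar_prod_sum[OF x x]
      by (intro tendsto_sum tendsto_mult tendsto_cnj vx) auto
  qed (simp add: v_unit)
  have x_ev: "pencil A C \<mu> *\<^sub>v x = complex_of_real (?e \<mu>) \<cdot>\<^sub>v x"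
  proof (rule eq_vecI)
    fix i assume "i < dim_vec (complex_of_real (?e \<mu>) \<cdot>\<^sub>v x)"
    then have i: "i < n"
      using x by simp
    show "(pencil A C \<mu> *\<^sub>v x) $ i = (complex_of_real (?e \<mu>) \<cdot>\<^sub>v x) $ i"
    proof (rule LIMSEQ_unique)
      show "(\<lambda>k. (pencil A C (s (g k)) *\<^sub>v v (s (g k))) $ i) \<longlonglongrightarrow> (pencil A C \<mu> *\<^sub>v x) $ i"
        unfolding index_mult_mat_vec_sum[OF P v i] index_mult_mat_vec_sum[OF P x i]
        using i by (intro tendsto_sum tendsto_mult vx entries') auto
      have "(complex_of_real a \<cdot>\<^sub>v v t) $ i = complex_of_real a * v t $ i" for a t
        using v[of t] i by simp
      then show "(\<lambda>k. (pencil A C (s (g k)) *\<^sub>v v (s (g k))) $ i) \<longlonglongrightarrow> (complex_of_real (?e \<mu>) \<cdot>\<^sub>v x) $ i"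
        unfolding v_ev using x i by (auto intro!: tendsto_intros e vx)
    qed
  qed (use x P[of \<mu>] in auto)
  \<comment> \<open>Pairing with the fixed limit \<open>x\<close> gives two scalar sequences:
    \<open>p\<close> tends to x^H x = 1, and \<open>q\<close> to x^H C x.\<close>
  define p where "p k = conjugate x \<bullet> v (s (g k))" for k
  define q where "q k = conjugate x \<bullet> (C *\<^sub>v v (s (g k)))" for k
  have p: "p \<longlonglongrightarrow> 1"
    unfolding x_unit[symmetric] p_def conjugate_scalar_prod_sum[OF x v] conjugate_scalar_prod_sum[OF x x]
    by (intro tendsto_sum tendsto_mult tendsto_const vx) auto
  have q: "q \<longlonglongrightarrow> conjugate x \<bullet> (C *\<^sub>v x)"
    unfolding q_def sesquilinear_form_sum[OF C x v] sesquilinear_form_sum[OF C x x]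
    by (intro tendsto_sum tendsto_mult tendsto_const vx) auto
  \<comment> \<open>Evaluate \<open>x\<^sup>H (A - s C) v\<close> in two ways: \<open>v\<close> is an eigenvector of \<open>A - s C\<close>, \<open>x\<close> of \<open>A - \<mu> C\<close>.\<close>
  have key: "complex_of_real (?e (s (g k)) - ?e \<mu>) * p k = - (complex_of_real (s (g k) - \<mu>) * q k)" for k
  proof -
    let ?t = "s (g k)"
    let ?v = "v ?t"
    have "complex_of_real (?e ?t) * p k = conjugate x \<bullet> (pencil A C ?t *\<^sub>v ?v)"
      unfolding v_ev p_def using x v[of ?t] by simp
    also have "\<dots> = conjugate x \<bullet> (pencil A C \<mu> *\<^sub>v ?v) - complex_of_real (?t - \<mu>) * q k"
      unfolding q_def sesquilinear_form_sum[OF P x v] sesquilinear_form_sum[OF C x v]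
        sum_distrib_left sum_subtractf[symmetric]
      using A C by (intro sum.cong refl) (simp add: pencil_def algebra_simps)
    \<comment> \<open>Hermitian symmetry moves the pencil at \<mu> onto its eigenvector
      \<open>x\<close>; the eigenvalue is real, so conjugating back leaves it unchanged.\<close>
    also have "conjugate x \<bullet> (pencil A C \<mu> *\<^sub>v ?v) = cnj (conjugate ?v \<bullet> (pencil A C \<mu> *\<^sub>v x))"
      by (rule hermitian_form_swap[OF P Ph x v])
    also have "\<dots> = complex_of_real (?e \<mu>) * p k"
      unfolding x_ev p_def using x v[of ?t]
      by (simp add: conjugate_scalar_prod_sum[of _ n] sum_distrib_left mult_ac)
    finally show ?thesis
      by (simp add: algebra_simps)
  qed
  \<comment> \<open>Dividing \<open>key\<close> by \<open>p k\<close> and by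
    \<open>s (g k) - \<mu>\<close> shows that this is the difference quotient as soon as
    \<open>p k\<close> is nonzero.\<close>
  have "(\<lambda>k. - q k / p k) \<longlonglongrightarrow> - (conjugate x \<bullet> (C *\<^sub>v x)) / 1"
    by (intro tendsto_divide tendsto_minus p q) simp
  moreover have "\<forall>\<^sub>F k in sequentially. p k \<noteq> 0"
    using p by (rule tendsto_imp_eventually_ne) simp
  then have "\<forall>\<^sub>F k in sequentially.
      - q k / p k = complex_of_real ((?e (s (g k)) - ?e \<mu>) / (s (g k) - \<mu>))"
  proof eventually_elim
    case (elim k)
    have "complex_of_real (s (g k) - \<mu>) \<noteq> 0"
      using s_ne[of "g k"] by simp
    then show ?case
      using key[of k] elim by (simp add: field_simps del: of_real_diff)
  qed
  ultimately have "(\<lambda>k. complex_of_real ((?e (s (g k)) - ?e \<mu>) / (s (g k) - \<mu>)))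
      \<longlonglongrightarrow> - (conjugate x \<bullet> (C *\<^sub>v x))"
    using tendsto_cong by force
  from tendsto_Re[OF this] show ?thesis
    using that x x_unit x_ev g by simp
qed

section \<open>An isotropic unit vector in the eigenspace\<close>

text \<open>The intermediate value theorem on the segment from \<open>u\<close> to \<open>v\<close>
  gives a zero of the form. Normalising it requires a nonzero vector: if the form vanishes at
  \<open>u\<close> or \<open>v\<close>, that vector serves directly; otherwise the strict signs keep
  the segment away from 0.\<close>

lemma hermitian_form_zero_in_eigenspace:
  assumes M: "M \<in> carrier_mat n n" and C: "C \<in> carrier_mat n n" and Ch: "hermitian_mat C"
    and u: "u \<in> carrier_vec n" and v: "v \<in> carrier_vec n"
    and uev: "M *\<^sub>v u = z \<cdot>\<^sub>v u" and vev: "M *\<^sub>v v = z \<cdot>\<^sub>v v"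
    and u_unit: "conjugate u \<bullet> u = 1" and v_unit: "conjugate v \<bullet> v = 1"
    and u_nn: "Re (conjugate u \<bullet> (C *\<^sub>v u)) \<ge> 0" and v_np: "Re (conjugate v \<bullet> (C *\<^sub>v v)) \<le> 0"
  shows "\<exists>x\<in>carrier_vec n. M *\<^sub>v x = z \<cdot>\<^sub>v x \<and> conjugate x \<bullet> (C *\<^sub>v x) = 0 \<and> conjugate x \<bullet> x = 1"
proof -
  have real: "conjugate x \<bullet> (C *\<^sub>v x) = complex_of_real (Re (conjugate x \<bullet> (C *\<^sub>v x)))"
    if "x \<in> carrier_vec n" for x
    using hermitian_form_swap[OF C Ch that that] by (metis Reals_cnj_iff of_real_Re)
  have scale: "conjugate (a \<cdot>\<^sub>v x) \<bullet> (C *\<^sub>v (a \<cdot>\<^sub>v x)) = cnj a * a * (conjugate x \<bullet> (C *\<^sub>v x))"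
    if x: "x \<in> carrier_vec n" for a x
  proof -
    have ax: "a \<cdot>\<^sub>v x \<in> carrier_vec n"
      using x by simp
    show ?thesis
      unfolding sesquilinear_form_sum[OF C ax ax] sesquilinear_form_sum[OF C x x] sum_distrib_left
      using x by (intro sum.cong refl) (simp add: mult_ac)
  qed
  show ?thesis
  proof (cases "Re (conjugate u \<bullet> (C *\<^sub>v u)) = 0 \<or> Re (conjugate v \<bullet> (C *\<^sub>v v)) = 0")
    case True
    then show ?thesis
      using real[OF u] real[OF v] u v uev vev u_unit v_unit by (metis of_real_0)
  next
    case False
    define w where "w t = complex_of_real (1 - t) \<cdot>\<^sub>v u + complex_of_real t \<cdot>\<^sub>v v" for t :: real
    define q where "q t = Re (conjugate (w t) \<bullet> (C *\<^sub>v w t))" for t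
    have w: "w t \<in> carrier_vec n" for t
      using u v by (simp add: w_def)
    have w_ev: "M *\<^sub>v w t = z \<cdot>\<^sub>v w t" for t
      using M u v unfolding w_def
      by (simp add: mult_add_distrib_mat_vec[of _ n n] smult_eigenvector[OF M _ uev]
          smult_eigenvector[OF M _ vev] smult_add_distrib_vec[of _ n])
    have w_index: "w t $ i = complex_of_real (1 - t) * u $ i + complex_of_real t * v $ i"
      if "i < n" for t i
      using that u v by (simp add: w_def)
    \<comment> \<open>Written out in coordinates, \<open>q\<close> is visibly continuous in
      \<open>t\<close>.\<close>
    have q_eq: "q t = Re (\<Sum>i<n. \<Sum>j<n. cnj (complex_of_real (1 - t) * u $ i + complex_of_real t * v $ i) *
        (C $$ (i, j) * (complex_of_real (1 - t) * u $ j + complex_of_real t * v $ j)))" for t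
      unfolding q_def sesquilinear_form_sum[OF C w w]
      by (intro arg_cong[where f = Re] sum.cong refl) (simp add: w_index)
    have "continuous_on {0..1} q"
      unfolding q_eq by (intro continuous_intros)
    moreover have "w 0 = u" "w 1 = v"
      using u v by (auto simp: w_def intro!: eq_vecI)
    then have "q 1 \<le> 0" "0 \<le> q 0"
      using u_nn v_np by (simp_all add: q_def)
    ultimately obtain t where t: "q t = 0"
      using IVT2'[of q 1 0 0] by auto
    \<comment> \<open>If \<open>w t\<close> were 0, then (1 - t) u = -t v. Comparing the form on
      both sides equates a nonnegative with a nonpositive number, so both are 0; as the form is
      nonzero at \<open>u\<close> and \<open>v\<close>, this forces t = 1 and t = 0 at once.\<close>
    have "w t \<noteq> 0\<^sub>v n"
    proof
      assume w0: "w t = 0\<^sub>v n"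
      have "complex_of_real (1 - t) \<cdot>\<^sub>v u = complex_of_real (- t) \<cdot>\<^sub>v v"
      proof (rule eq_vecI)
        fix i assume "i < dim_vec (complex_of_real (- t) \<cdot>\<^sub>v v)"
        then have "i < n"
          using v by simp
        then show "(complex_of_real (1 - t) \<cdot>\<^sub>v u) $ i = (complex_of_real (- t) \<cdot>\<^sub>v v) $ i"
          using w_index[of i t] u v by (simp add: w0 eq_neg_iff_add_eq_0)
      qed (use u v in auto)
      then have "(1 - t)\<^sup>2 * Re (conjugate u \<bullet> (C *\<^sub>v u)) = t\<^sup>2 * Re (conjugate v \<bullet> (C *\<^sub>v v))"
        using arg_cong[OF scale[OF u, of "complex_of_real (1 - t)"], of Re]
          arg_cong[OF scale[OF v, of "complex_of_real (- t)"], of Re]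
        by (simp add: power2_eq_square flip: of_real_mult of_real_diff of_real_minus del: of_real_mult of_real_diff of_real_minus)
      moreover have "(1 - t)\<^sup>2 * Re (conjugate u \<bullet> (C *\<^sub>v u)) \<ge> 0"
        using u_nn by simp
      moreover have "t\<^sup>2 * Re (conjugate v \<bullet> (C *\<^sub>v v)) \<le> 0"
        using v_np by (simp add: mult_nonneg_nonpos)
      ultimately have "(1 - t)\<^sup>2 * Re (conjugate u \<bullet> (C *\<^sub>v u)) = 0"
        "t\<^sup>2 * Re (conjugate v \<bullet> (C *\<^sub>v v)) = 0"
        by linarith+
      then show False
        using False by auto
    qed
    then obtain a where a: "conjugate (complex_of_real a \<cdot>\<^sub>v w t) \<bullet> (complex_of_real a \<cdot>\<^sub>v w t) = 1"
      using smult_unit_vec_exists[OF w] by blast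
    \<comment> \<open>\<open>q\<close> records only the real part, but the form of a Hermitian
      matrix is real. Rescaling multiplies it by |a|^2 and so keeps the zero.\<close>
    have "conjugate (w t) \<bullet> (C *\<^sub>v w t) = 0"
      using real[OF w, of t] t by (simp add: q_def)
    then show ?thesis
      using a w[of t] scale[OF w, of "complex_of_real a" t] smult_eigenvector[OF M w w_ev]
      by (intro bexI[of _ "complex_of_real a \<cdot>\<^sub>v w t"]) auto
  qed
qed

section \<open>One-sided limits at a local extremum\<close>

theorem theorem5p2:
  fixes A C :: "complex mat" and n j :: nat and \<mu> l :: real
  assumes "A \<in> carrier_mat n n" and "C \<in> carrier_mat n n"
    and "hermitian_mat A" and "hermitian_mat C" and "indefinite_mat C"
    and "j \<in> {1..n}"
    and "l = eigencurve A C j \<mu>"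
    and "local_minimizer (eigencurve A C j) \<mu> \<or> local_maximizer (eigencurve A C j) \<mu>"
  shows "two_d_eigenvalue A C (\<mu>, l)"
proof -
  note quotient = eigencurve_difference_quotient[OF assms(1-4,6)]
  let ?e = "eigencurve A C j"
  \<comment> \<open>Strictly positive steps, so neither of the sequences \<mu> + \<open>?r k\<close>
    and \<mu> - \<open>?r k\<close> ever meets \<mu>.\<close>
  let ?r = "\<lambda>k. inverse (real (Suc k))"
  have r: "?r \<longlonglongrightarrow> 0"
    by (rule LIMSEQ_inverse_real_of_nat)
  have right: "(\<lambda>k. \<mu> + ?r k) \<longlonglongrightarrow> \<mu>" and left: "(\<lambda>k. \<mu> - ?r k) \<longlonglongrightarrow> \<mu>"
    using tendsto_add[OF tendsto_const r, of \<mu>] tendsto_diff[OF tendsto_const r, of \<mu>] by simp_all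
  obtain u g where u: "u \<in> carrier_vec n" "conjugate u \<bullet> u = 1"
      "pencil A C \<mu> *\<^sub>v u = complex_of_real l \<cdot>\<^sub>v u"
    and g: "strict_mono (g :: nat \<Rightarrow> nat)"
    and u_lim: "(\<lambda>k. (?e (\<mu> + ?r (g k)) - l) / ?r (g k)) \<longlonglongrightarrow> - Re (conjugate u \<bullet> (C *\<^sub>v u))"
    by (rule quotient[OF right]) (auto simp: assms(7))
  obtain v h where v: "v \<in> carrier_vec n" "conjugate v \<bullet> v = 1"
      "pencil A C \<mu> *\<^sub>v v = complex_of_real l \<cdot>\<^sub>v v"
    and h: "strict_mono (h :: nat \<Rightarrow> nat)"
    and v_lim: "(\<lambda>k. (?e (\<mu> - ?r (h k)) - l) / - ?r (h k)) \<longlonglongrightarrow> - Re (conjugate v \<bullet> (C *\<^sub>v v))"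
    by (rule quotient[OF left]) (auto simp: assms(7))
  \<comment> \<open>Whatever holds near \<mu> holds eventually along both subsequences.\<close>
  have near: "\<forall>\<^sub>F k in sequentially. Q (\<mu> + ?r (g k)) \<and> Q (\<mu> - ?r (h k))"
    if "\<forall>\<^sub>F t in nhds \<mu>. Q t" for Q
    using LIMSEQ_subseq_LIMSEQ[OF right g] LIMSEQ_subseq_LIMSEQ[OF left h] that
    by (auto simp: filterlim_iff o_def eventually_conj_iff)
  have "\<exists>x\<in>carrier_vec n. pencil A C \<mu> *\<^sub>v x = complex_of_real l \<cdot>\<^sub>v x \<and>
      conjugate x \<bullet> (C *\<^sub>v x) = 0 \<and> conjugate x \<bullet> x = 1"
    using assms(8)
  proof
    assume "local_minimizer ?e \<mu>"
    \<comment> \<open>Both numerators are nonnegative, but the denominators are positive on the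
      right and negative on the left. So the form of \<open>C\<close> is nonpositive at
      \<open>u\<close> and nonnegative at \<open>v\<close>, and \<open>v\<close> takes the first
      place below.\<close>
    then have ev: "\<forall>\<^sub>F k in sequentially. l \<le> ?e (\<mu> + ?r (g k)) \<and> l \<le> ?e (\<mu> - ?r (h k))"
      unfolding local_minimizer_def assms(7) by (rule near)
    have "0 \<le> - Re (conjugate u \<bullet> (C *\<^sub>v u))"
      by (rule tendsto_lowerbound[OF u_lim]) (use ev in \<open>auto elim!: eventually_mono\<close>)
    moreover have "- Re (conjugate v \<bullet> (C *\<^sub>v v)) \<le> 0"
      by (rule tendsto_upperbound[OF v_lim]) (use ev in \<open>auto elim!: eventually_mono intro!: divide_nonneg_neg\<close>)
    ultimately show ?thesis
      by (intro hermitian_form_zero_in_eigenspace[OF pencil_carrier[OF assms(1,2)] assms(2,4)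
            v(1) u(1) v(3) u(3) v(2) u(2)]) auto
  next
    assume "local_maximizer ?e \<mu>"
    \<comment> \<open>The numerators are now nonpositive, so \<open>u\<close> and \<open>v\<close>
      exchange roles.\<close>
    then have ev: "\<forall>\<^sub>F k in sequentially. ?e (\<mu> + ?r (g k)) \<le> l \<and> ?e (\<mu> - ?r (h k)) \<le> l"
      unfolding local_maximizer_def assms(7) by (rule near)
    have "- Re (conjugate u \<bullet> (C *\<^sub>v u)) \<le> 0"
      by (rule tendsto_upperbound[OF u_lim])
        (use ev in \<open>auto elim!: eventually_mono intro!: divide_nonpos_pos\<close>)
    moreover have "0 \<le> - Re (conjugate v \<bullet> (C *\<^sub>v v))"
      by (rule tendsto_lowerbound[OF v_lim])
        (use ev in \<open>auto elim!: eventually_mono intro!: divide_nonpos_pos\<close>)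
    ultimately show ?thesis
      by (intro hermitian_form_zero_in_eigenspace[OF pencil_carrier[OF assms(1,2)] assms(2,4)
            u(1) v(1) u(3) v(3) u(2) v(2)]) auto
  qed
  then show ?thesis
    using assms(1) by (simp add: two_d_eigenvalue_def)
qed

end
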